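(* Let $D=1$, let $A\ge 1$ be real, and let $\lambda$ be a positive integer with $$\lambda \ge \max\left(\tfrac{4}{3}A+\tfrac{4}{3},\; 3+\tfrac{3}{A}\right).$$ Let $n$ be a positive integer whose standard binary expansion is $N_{\mathcal B}=n_\lambda\dots n_0$ with $n_\lambda=1$. Let $N^*=n^*_{\lambda+1}\dots n^*_0$ be the output of Algorithm 2 on $N_{\mathcal B}$ if $A\ge 2$, and the output of Algorithm 3 on $N_{\mathcal B}$ with parameter $\alpha=A$ if $1\le A<2$. Then $$T(N^*,\lambda+1)\;\le\; \lambda D+\frac{A}{2A+1}(\lambda+1)A,$$ where the right-hand side is the worst-case computation time of Nöcker's parallel scalar multiplication algorithm with $p=2$ processors.
   Context: Representations: for a positive integer $n$ and a digit set $\mathcal S$ with $\{0,1\}\subseteq\mathcal S\subseteq\mathbb Z$, a representation of $n$ is a string $n_\lambda\dots n_0$ with $n_i\in\mathcal S$ and $\sum_i n_i2^i=n$. A canonical representation uses $\mathcal S=\{-1,0,1\}$; $\bar 1$ denotes $-1$. Strings are written most significant digit first. In patterns, $x^k$ denotes $k$ repetitions, $x^*$ denotes zero or more repetitions (regular-expression notation), and "a string ends with a pattern" means some suffix of it matches the pattern. Time model: fix reals $D>0$ (doubling time) and $A\ge 0$ (addition time). For a digit string $N=n_\lambda\dots n_0$ with integer digits, define recursively for $0\le i\le\lambda$: $T(N,i)=0$ if $i=0$ and $n_0=0$; $T(N,i)=T(N,i-1)$ if $i>0$ and $n_i=0$; $T(N,i)=iD+(|n_i|-1)A$ if $n_i\ne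 0$ and $n_j=0$ for all $0\le j<i$; and $T(N,i)=\max(T(N,i-1),iD)+|n_i|A$ otherwise. toNAF$(N,i)$ (Algorithm 1): input a digit string $N=n_\lambda\dots n_0$ and a starting index $i$. Set $n'_j\leftarrow n_j$ for $j\le\lambda$ and $n'_{\lambda+1}\leftarrow 0$. While $i<\lambda$: if $n'_i=1$ and $n'_{i+1}=1$, then set $n'_i\leftarrow -1$, $i\leftarrow i+1$; while $n'_i=1$ set $n'_i\leftarrow 0$, $i\leftarrow i+1$; then set $n'_i\leftarrow 1$ (and continue the outer loop without incrementing $i$). Otherwise $i\leftarrow i+1$. Return $n'_{\lambda+1}\dots n'_0$. Algorithm 2: input $N_{\mathcal B}=n_\lambda\dots n_0$ (standard binary expansion of $n$). Let $\ell$ be the index of the least significant $1$. The pattern tests are applied to the string $00n_\lambda\dots n_0$ (two leading zeros prepended). If it ends with $11(01)^*010^*$: set $n_\ell\leftarrow -1$, $n_{\ell+1}\leftarrow 1$ and return toNAF$(N_{\mathcal B},\ell+1)$. Else if it ends with $0(01)^*0110^*$: return toNAF$(N_{\mathcal B},\ell+1)$. Else return toNAF$(N_{\mathcal B},\ell)$. Algorithm 3 (parameter $\alpha$): input $N_{\mathcal B}=n_\lambda\dots n_0$. Set $n'_j\leftarrow n_j$ for $j\le\lambda$, $n'_{\lambda+1}\leftarrow 0$, $\ell\leftarrow$ index of the least significant $1$, $d\leftarrow 0$. For $i=\ell+1,\dots,\lambda+1$: if $n'_i=1$, set $d\leftarrow\max(d+(\alpha-1),\alpha)$; otherwise set $d\leftarrow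 d-1$, and then if $d>\alpha$: set $n'_\ell\leftarrow -1$, $n'_j\leftarrow n'_j-1$ for all $\ell<j<i$, $n'_i\leftarrow 1$, $d\leftarrow\alpha$, $\ell\leftarrow i$; else if $d\le 1$: set $\ell\leftarrow i+1$. Return $n'_{\lambda+1}\dots n'_0$. *)

theory Defs
  imports Complex_Main "HOL-Library.While_Combinator" "HOL-Library.Sublist"
begin

(* A digit string n_lam ... n_0 is encoded by the list N = [n_0, ..., n_lam], least significant
   digit first, so that N ! i is the digit n_i and lam = length N - 1.  Since strings are written
   most significant digit first, the string as written is rev N. *)

definition digit_value :: "int list \<Rightarrow> int" where
  "digit_value N = (\<Sum>i<length N. N ! i * 2 ^ i)"

definition representation :: "int set \<Rightarrow> int list \<Rightarrow> nat \<Rightarrow> bool" where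
  "representation S N n \<longleftrightarrow> set N \<subseteq> S \<and> digit_value N = int n"

definition binary_expansion :: "int list \<Rightarrow> nat \<Rightarrow> bool" where
  "binary_expansion N n \<longleftrightarrow> representation {0, 1} N n \<and> N \<noteq> [] \<and> last N = 1"

function comp_time :: "real \<Rightarrow> real \<Rightarrow> int list \<Rightarrow> nat \<Rightarrow> real" where
  "comp_time D A N i =
    (if i = 0 \<and> N ! 0 = 0 then 0
     else if i > 0 \<and> N ! i = 0 then comp_time D A N (i - 1)
     else if N ! i \<noteq> 0 \<and> (\<forall>j<i. N ! j = 0) then real i * D + (\<bar>real_of_int (N ! i)\<bar> - 1) * A
     else max (comp_time D A N (i - 1)) (real i * D) + \<bar>real_of_int (N ! i)\<bar> * A)"
  by auto
termination
  by (relation "measure (\<lambda>(D, A, N, i). i)") auto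

declare comp_time.simps [simp del]

definition lsb_index :: "int list \<Rightarrow> nat" where
  "lsb_index N = (LEAST i. i < length N \<and> N ! i = 1)"

definition clear_ones :: "int list \<times> nat \<Rightarrow> int list \<times> nat" where
  "clear_ones = while (\<lambda>(N, i). N ! i = 1) (\<lambda>(N, i). (N[i := 0], i + 1))"

definition toNAF_step :: "int list \<times> nat \<Rightarrow> int list \<times> nat" where
  "toNAF_step = (\<lambda>(N, i).
     if N ! i = 1 \<and> N ! (i + 1) = 1
     then (case clear_ones (N[i := - 1], i + 1) of (N', k) \<Rightarrow> (N'[k := 1], k))
     else (N, i + 1))"

(* lam is taken from the input string, before the leading zero is prepended.  That zero is what
   stops the inner loop within the string, so both loops terminate on every input. *)

definition toNAF :: "int list \<Rightarrow> nat \<Rightarrow> int list" where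
  "toNAF N i =
     (let lam = length N - 1
      in fst (while (\<lambda>(N', k). k < lam) toNAF_step (N @ [0], i)))"

(* The languages 11(01)^*010^* and 0(01)^*0110^*, as lists read most significant digit first. *)

definition pattern1 :: "int list set" where
  "pattern1 = {[1, 1] @ concat (replicate a [0, 1]) @ [0, 1] @ replicate b 0 | a b. True}"

definition pattern2 :: "int list set" where
  "pattern2 = {[0] @ concat (replicate a [0, 1]) @ [0, 1, 1] @ replicate b 0 | a b. True}"

definition ends_with :: "int list \<Rightarrow> int list set \<Rightarrow> bool" where
  "ends_with s P \<longleftrightarrow> (\<exists>w\<in>P. suffix w s)"

definition algorithm2 :: "int list \<Rightarrow> int list" where
  "algorithm2 N =
     (let l = lsb_index N; s = [0, 0] @ rev N
      in if ends_with s pattern1 then toNAF (N[l := - 1, l + 1 := 1]) (l + 1)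
         else if ends_with s pattern2 then toNAF N (l + 1)
         else toNAF N l)"

definition recode_block :: "int list \<Rightarrow> nat \<Rightarrow> nat \<Rightarrow> int list" where
  "recode_block N l i =
     map (\<lambda>j. if j = l then - 1 else if l < j \<and> j < i then N ! j - 1
              else if j = i then 1 else N ! j) [0..<length N]"

(* The loop state is (n', l, d). *)

definition algorithm3_step ::
    "real \<Rightarrow> nat \<Rightarrow> int list \<times> nat \<times> real \<Rightarrow> int list \<times> nat \<times> real" where
  "algorithm3_step \<alpha> i = (\<lambda>(N, l, d).
     if N ! i = 1 then (N, l, max (d + (\<alpha> - 1)) \<alpha>)
     else let d' = d - 1
          in if d' > \<alpha> then (recode_block N l i, i, \<alpha>)
             else if d' \<le> 1 then (N, i + 1, d')
             else (N, l, d'))"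

(* The loop runs over i = l+1, ..., lam+1 for the initial value of l; note length N = lam + 1. *)

definition algorithm3 :: "real \<Rightarrow> int list \<Rightarrow> int list" where
  "algorithm3 \<alpha> N =
     (let l = lsb_index N
      in fst (fold (algorithm3_step \<alpha>) [l + 1..<length N + 1] (N @ [0], l, 0)))"

end

theory Submission
  imports Defs
begin

text \<open>
  For digits of absolute value at most one, let \<open>e\<close> be the excess of the time over the position.
  A zero digit lowers \<open>e\<close> by one, and a nonzero digit replaces it by at most \<open>max (e + A - 1) A\<close>.

  For \<open>A \<ge> 2\<close>, the output of Algorithm 2 has no two adjacent nonzero digits, except possibly the two
  lowest ones, whatever the outcome of the pattern tests; this alone gives a time of at most
  \<open>1 + (lam + 2) * A / 2\<close>.

  For \<open>A < 2\<close>, the variable \<open>d\<close> of Algorithm 3 bounds the excess of the current string.  The current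
  block, if it were recoded, would have excess at most \<open>2 * A - d\<close>: each digit is zero in
  one of the two versions of the block and nonzero in the other, so the sum of the two excesses
  changes by \<open>A - 2 \<le> 0\<close> unless one of them is reset to \<open>A\<close> while the other is at most \<open>A\<close>.  Hence recoding once
  \<open>d - 1\<close> exceeds \<open>A\<close> brings the excess down to \<open>A\<close>.  As \<open>d \<le> A\<close> after every zero, in particular after
  the leading one, the total time is at most \<open>lam + 1 + A\<close>.
\<close>

section \<open>Computation time\<close>

text \<open>Allows a string to be compared with its recodings, which may differ from it above
  position \<open>i\<close>.\<close>

lemma comp_time_cong:
  assumes "\<And>j. j \<le> i \<Longrightarrow> M ! j = N ! j"
  shows "comp_time D A M i = comp_time D A N i"
  using assms
proof (induction i)
  case 0
  then show ?case by (simp add: comp_time.simps)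
next
  case (Suc i)
  then have "comp_time D A M i = comp_time D A N i" by simp
  moreover have "(\<forall>j<Suc i. M ! j = 0) = (\<forall>j<Suc i. N ! j = 0)"
    using Suc.prems by (metis less_imp_le)
  ultimately show ?case
    using Suc.prems[of "Suc i"]
    by (auto simp: comp_time.simps[of D A M "Suc i"] comp_time.simps[of D A N "Suc i"])
qed

lemma comp_time_zero_digit:
  assumes "i > 0" "N ! i = 0"
  shows "comp_time D A N i = comp_time D A N (i - 1)"
  using assms by (simp add: comp_time.simps[of D A N i])

lemma comp_time_lowest_digit:
  assumes "\<bar>N ! i\<bar> = 1" "\<And>j. j < i \<Longrightarrow> N ! j = 0"
  shows "comp_time D A N i = real i * D"
proof -
  have "\<bar>real_of_int (N ! i)\<bar> = 1" using assms(1) by linarith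
  moreover have "N ! i \<noteq> 0" using assms(1) by auto
  ultimately show ?thesis
    using assms(2) by (auto simp: comp_time.simps[of D A N i])
qed

lemma comp_time_digit_le:
  assumes "i > 0" "\<bar>N ! i\<bar> \<le> 1" "A \<ge> 0"
  shows "comp_time D A N i \<le> max (comp_time D A N (i - 1)) (real i * D) + A"
proof -
  have "\<bar>real_of_int (N ! i)\<bar> \<le> 1" using assms(2) by linarith
  then have 1: "\<bar>real_of_int (N ! i)\<bar> * A \<le> A"
    using assms(3) mult_right_mono[of "\<bar>real_of_int (N ! i)\<bar>" 1 A] by simp
  then have "(\<bar>real_of_int (N ! i)\<bar> - 1) * A \<le> 0" by (simp add: algebra_simps)
  with 1 show ?thesis
    using assms(1,3) by (subst comp_time.simps) (auto simp: max_def)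
qed

text \<open>The bound grows by \<open>A / 2\<close> per position, so a nonzero digit and the zero
  before it together pay for one addition. A nonzero pair at \<open>s - 1\<close> and
  \<open>s\<close> is tolerated: the digit at \<open>s - 1\<close> is then the lowest nonzero one
  and needs no addition.\<close>

lemma comp_time_nonadjacent_le:
  assumes A: "A \<ge> 2"
    and dig: "\<And>j. j \<le> i \<Longrightarrow> \<bar>N ! j\<bar> \<le> 1"
    and low: "\<And>j. Suc j < s \<Longrightarrow> N ! j = 0"
    and naf: "\<And>j. s \<le> j \<Longrightarrow> j < i \<Longrightarrow> N ! j = 0 \<or> N ! Suc j = 0"
  shows "comp_time 1 A N i \<le> 1 + real (if N ! i = 0 then i else Suc i) * A / 2"
  using dig naf
proof (induction i)
  case 0
  have "comp_time 1 A N 0 = 0"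
  proof (cases "N ! 0 = 0")
    case True
    then show ?thesis by (simp add: comp_time.simps)
  next
    case False
    then have "\<bar>N ! 0\<bar> = 1" using "0.prems"(1)[of 0] by auto
    then show ?thesis using comp_time_lowest_digit[of N 0 1 A] by simp
  qed
  then show ?case using A by simp
next
  case (Suc i)
  have IH: "comp_time 1 A N i \<le> 1 + real (if N ! i = 0 then i else Suc i) * A / 2"
    using Suc by simp
  \<comment> \<open>Hence waiting for the doubling at \<open>i + 1\<close> stays within
    \<open>1 + i * A / 2\<close>.\<close>
  have iA: "real i \<le> real i * A / 2"
    using A mult_left_mono[of 2 A "real i"] by simp
  consider (zero) "N ! Suc i = 0"
    | (sparse) "N ! Suc i \<noteq> 0" "N ! i = 0"
    | (lowest) "N ! Suc i \<noteq> 0" "N ! i \<noteq> 0" by blast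
  then show ?case
  proof cases
    case zero
    then have "comp_time 1 A N (Suc i) = comp_time 1 A N i"
      using comp_time_zero_digit[of "Suc i" N] by simp
    then show ?thesis using IH zero A by (auto simp: algebra_simps add_divide_distrib split: if_splits)
  next
    case sparse
    then have "comp_time 1 A N (Suc i) \<le> max (comp_time 1 A N i) (real (Suc i)) + A"
      using comp_time_digit_le[of "Suc i" N A 1] Suc.prems(1)[of "Suc i"] A by simp
    then show ?thesis using IH sparse A iA by (auto simp: algebra_simps add_divide_distrib max_def split: if_splits)
  next
    case lowest
    then have "i < s" using Suc.prems(2)[of i] by force
    then have "comp_time 1 A N i = real i"
      using comp_time_lowest_digit[of N i 1 A] lowest Suc.prems(1)[of i] low by force
    moreover have "comp_time 1 A N (Suc i) \<le> max (comp_time 1 A N i) (real (Suc i)) + A"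
      using comp_time_digit_le[of "Suc i" N A 1] Suc.prems(1)[of "Suc i"] A by simp
    ultimately show ?thesis using lowest A iA by (auto simp: algebra_simps add_divide_distrib max_def)
  qed
qed

section \<open>Algorithm 2\<close>

text \<open>Position \<open>m\<close> holds a sentinel that stops the loop, so \<open>m - k\<close>
  serves as termination measure.\<close>

lemma clear_ones_spec:
  assumes "i \<le> m" "m < length N" "N ! m \<noteq> 1" "clear_ones (N, i) = (N', k)"
  shows "i \<le> k \<and> k \<le> m \<and> N ! k \<noteq> 1 \<and> (\<forall>j. i \<le> j \<longrightarrow> j < k \<longrightarrow> N ! j = 1)
    \<and> length N' = length N \<and> (\<forall>j. N' ! j = (if i \<le> j \<and> j < k then 0 else N ! j))"
proof -
  let ?P = "\<lambda>(N', k). i \<le> k \<and> k \<le> m \<and> (\<forall>j. i \<le> j \<longrightarrow> j < k \<longrightarrow> N ! j = 1)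
    \<and> length N' = length N \<and> (\<forall>j. N' ! j = (if i \<le> j \<and> j < k then 0 else N ! j))"
  let ?Q = "\<lambda>(N', k). i \<le> k \<and> k \<le> m \<and> N ! k \<noteq> 1 \<and> (\<forall>j. i \<le> j \<longrightarrow> j < k \<longrightarrow> N ! j = 1)
    \<and> length N' = length N \<and> (\<forall>j. N' ! j = (if i \<le> j \<and> j < k then 0 else N ! j))"
  have "?Q (clear_ones (N, i))"
    unfolding clear_ones_def
  proof (rule while_rule[where P = ?P and r = "measure (\<lambda>(N', k). m - k)"])
    show "?P (N, i)" using assms by auto
  next
    fix x assume x: "?P x" "case x of (N, i) \<Rightarrow> N ! i = 1"
    obtain N' k where [simp]: "x = (N', k)" by fastforce
    have k: "N ! k = 1" "k \<le> m" using x by (auto split: if_splits)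
    then have km: "k < m" using assms by (metis le_neq_implies_less)
    show "?P (case x of (N, i) \<Rightarrow> (N[i := 0], i + 1))"
      using x k km assms by (auto simp: nth_list_update less_Suc_eq)
    show "(case x of (N, i) \<Rightarrow> (N[i := 0], i + 1), x) \<in> measure (\<lambda>(N', k). m - k)"
      using km by auto
  qed (auto split: if_splits)
  then show ?thesis using assms(4) by simp
qed

definition naf_upto :: "int list \<Rightarrow> nat \<Rightarrow> nat \<Rightarrow> bool" where
  "naf_upto M s k \<longleftrightarrow> (\<forall>j. s \<le> j \<longrightarrow> j < k \<longrightarrow> \<bar>M ! j\<bar> \<le> 1 \<and> (M ! j = 0 \<or> M ! Suc j = 0))"

lemma toNAF_spec:
  assumes len: "length N = lam + 1" and s: "s \<le> lam + 1"
    and bin: "\<And>j. s \<le> j \<Longrightarrow> j \<le> lam \<Longrightarrow> N ! j \<in> {0, 1}"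
  shows "naf_upto (toNAF N s) s (lam + 1) \<and> \<bar>toNAF N s ! (lam + 1)\<bar> \<le> 1
    \<and> (\<forall>j<s. toNAF N s ! j = (N @ [0]) ! j)"
proof -
  \<comment> \<open>Digits from \<open>k\<close> on are still binary, and the top digit stays zero
    while \<open>k \<le> lam\<close>, as sentinel for the inner loop. A later step may turn digit
    \<open>k\<close> from 1 into -1, which does not affect the pair
    \<open>(k - 1, k)\<close>.\<close>
  let ?P = "\<lambda>(M, k). length M = lam + 2 \<and> s \<le> k \<and> k \<le> lam + 1
    \<and> (\<forall>j. k \<le> j \<longrightarrow> j \<le> lam + 1 \<longrightarrow> M ! j \<in> {0, 1})
    \<and> (k \<le> lam \<longrightarrow> M ! (lam + 1) = 0)
    \<and> naf_upto M s k
    \<and> (\<forall>j<s. M ! j = (N @ [0]) ! j)"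
  let ?Q = "\<lambda>x. naf_upto (fst x) s (lam + 1) \<and> \<bar>fst x ! (lam + 1)\<bar> \<le> 1
    \<and> (\<forall>j<s. fst x ! j = (N @ [0]) ! j)"
  have "?Q (while (\<lambda>(N', k). k < lam) toNAF_step (N @ [0], s))"
  proof (rule while_rule[where P = ?P and r = "measure (\<lambda>(N', k). lam - k)"])
    show "?P (N @ [0], s)"
      using len s bin by (auto simp: nth_append naf_upto_def le_Suc_eq)
  next
    fix x assume x: "?P x" "case x of (N', k) \<Rightarrow> k < lam"
    obtain M k where [simp]: "x = (M, k)" by fastforce
    have M: "length M = lam + 2" "s \<le> k" "k < lam" "M ! (lam + 1) = 0"
      "\<And>j. k \<le> j \<Longrightarrow> j \<le> lam + 1 \<Longrightarrow> M ! j = 0 \<or> M ! j = 1"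
      "naf_upto M s k" "\<And>j. j < s \<Longrightarrow> M ! j = (N @ [0]) ! j"
      using x by auto
    have "?P (toNAF_step x) \<and> k < snd (toNAF_step x)"
    proof (cases "M ! k = 1 \<and> M ! (k + 1) = 1")
      case True
      obtain M' m where c: "clear_ones (M[k := - 1], k + 1) = (M', m)" by fastforce
      have step: "toNAF_step x = (M'[m := 1], m)"
        using True c by (simp add: toNAF_step_def)
      have spec: "k + 1 \<le> m" "m \<le> lam + 1" "M[k := - 1] ! m \<noteq> 1" "length M' = lam + 2"
        and M': "\<And>j. M' ! j = (if k + 1 \<le> j \<and> j < m then 0 else M[k := - 1] ! j)"
        using clear_ones_spec[OF _ _ _ c, of "lam + 1"] M(1,3,4) by auto
      \<comment> \<open>Digit \<open>k + 1\<close> was 1 as well, so at least one cleared digit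
        separates the new -1 from the carry.\<close>
      have m: "k + 2 \<le> m"
        using spec(1,3) True M(1,3) by (cases "m = k + 1") (auto simp: nth_list_update)
      have nth: "M'[m := 1] ! j =
          (if j = m then 1 else if j = k then - 1 else if k < j \<and> j < m then 0 else M ! j)"
        if "j \<le> lam + 1" for j
        using that spec M(1,3) m by (auto simp: nth_list_update M')
      have "naf_upto (M'[m := 1]) s m"
        unfolding naf_upto_def
      proof (intro allI impI)
        fix j assume j: "s \<le> j" "j < m"
        show "\<bar>M'[m := 1] ! j\<bar> \<le> 1 \<and> (M'[m := 1] ! j = 0 \<or> M'[m := 1] ! Suc j = 0)"
        proof (cases "j < k")
          case less: True
          then have *: "\<bar>M ! j\<bar> \<le> 1" "M ! j = 0 \<or> M ! Suc j = 0"
            using M(6) j by (auto simp: naf_upto_def)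
          then have "Suc j = k \<Longrightarrow> M ! j = 0" using True by auto
          then show ?thesis using * less j m spec(2) nth[of j] nth[of "Suc j"] by auto
        next
          case False
          then show ?thesis using j m spec(2) nth[of j] nth[of "Suc j"] by auto
        qed
      qed
      then show ?thesis
        unfolding step using M spec m nth by (simp del: nth_list_update_neq)
    next
      case False
      then have "M ! k = 0 \<or> M ! Suc k = 0"
        using M(3) M(5)[of k] M(5)[of "Suc k"] by auto
      then have "naf_upto M s (Suc k)"
        using M(5)[of k] M(3,6) by (auto simp: naf_upto_def less_Suc_eq)
      then show ?thesis using False M by (auto simp: toNAF_step_def)
    qed
    then show "?P (toNAF_step x)" "(toNAF_step x, x) \<in> measure (\<lambda>(N', k). lam - k)"
      using M(3) by (auto simp: case_prod_beta)
  next
    fix x assume x: "?P x" "\<not> (case x of (N', k) \<Rightarrow> k < lam)"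
    obtain M k where [simp]: "x = (M, k)" by fastforce
    \<comment> \<open>The index ends at \<open>lam\<close> or, after a final carry or if
      \<open>s = lam + 1\<close>, at \<open>lam + 1\<close>.\<close>
    have "naf_upto M s (lam + 1)"
    proof (cases "k = lam")
      case True
      then have "M ! lam \<in> {0, 1}" "M ! Suc lam = 0" using x by auto
      then show ?thesis using x True by (auto simp: naf_upto_def less_Suc_eq)
    next
      case False
      then have "k = lam + 1" using x by simp
      then show ?thesis using x by simp
    qed
    then show "?Q x" using x by (auto dest!: spec[of _ "lam + 1"])
  qed auto
  then show ?thesis by (simp add: toNAF_def len)
qed

section \<open>The lowest one, and the time of Algorithm 2\<close>

lemma lsb_index_spec:
  assumes "binary_expansion N n"
  shows "lsb_index N < length N" "N ! lsb_index N = 1" "j < lsb_index N \<Longrightarrow> N ! j = 0"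
proof -
  have N: "set N \<subseteq> {0, 1}" "N \<noteq> []" "last N = 1"
    using assms by (auto simp: binary_expansion_def representation_def)
  then have ex: "length N - 1 < length N \<and> N ! (length N - 1) = 1"
    by (simp add: last_conv_nth)
  show 1: "lsb_index N < length N" "N ! lsb_index N = 1"
    using LeastI[of "\<lambda>i. i < length N \<and> N ! i = 1", OF ex] unfolding lsb_index_def by auto
  show "N ! j = 0" if "j < lsb_index N"
    using not_less_Least[OF that[unfolded lsb_index_def]] that 1(1) N(1) nth_mem[of j N] by fastforce
qed

lemma binary_expansion_nth:
  assumes "binary_expansion N n" "j < length N"
  shows "N ! j = 0 \<or> N ! j = 1"
  using assms nth_mem[of j N] by (force simp: binary_expansion_def representation_def)

lemma comp_time_toNAF_le:
  assumes A: "A \<ge> 2" and len: "length N = lam + 1" and s: "s \<le> lam + 1"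
    and bin: "\<And>j. s \<le> j \<Longrightarrow> j \<le> lam \<Longrightarrow> N ! j \<in> {0, 1}"
    and low: "\<And>j. Suc j < s \<Longrightarrow> N ! j = 0"
    and dig: "\<And>j. j < s \<Longrightarrow> \<bar>N ! j\<bar> \<le> 1"
  shows "comp_time 1 A (toNAF N s) (lam + 1) \<le> 1 + (real lam + 2) * A / 2"
proof -
  let ?M = "toNAF N s"
  have M: "naf_upto ?M s (lam + 1)" "\<bar>?M ! (lam + 1)\<bar> \<le> 1"
    "\<And>j. j < s \<Longrightarrow> ?M ! j = N ! j"
    using toNAF_spec[OF len s bin] len s by (auto simp: nth_append)
  have "\<bar>?M ! j\<bar> \<le> 1" if "j \<le> lam + 1" for j
  proof (cases "j < s")
    case True
    then show ?thesis using M(3) dig by simp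
  next
    case False
    then show ?thesis using M(1,2) that by (cases "j = lam + 1") (auto simp: naf_upto_def)
  qed
  then have "comp_time 1 A ?M (lam + 1)
      \<le> 1 + real (if ?M ! (lam + 1) = 0 then lam + 1 else Suc (lam + 1)) * A / 2"
    by (rule comp_time_nonadjacent_le[OF A, where s = s])
      (use M(1,3) low in \<open>auto simp: naf_upto_def\<close>)
  also have "\<dots> \<le> 1 + (real lam + 2) * A / 2"
    using A by (auto simp: algebra_simps)
  finally show ?thesis .
qed

lemma comp_time_algorithm2_le:
  assumes A: "A \<ge> 2" and bin: "binary_expansion N n" and len: "length N = lam + 1"
  shows "comp_time 1 A (algorithm2 N) (lam + 1) \<le> 1 + (real lam + 2) * A / 2"
proof -
  define l where "l = lsb_index N"
  have l: "l \<le> lam" "N ! l = 1" "\<And>j. j < l \<Longrightarrow> N ! j = 0"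
    using lsb_index_spec[OF bin] len by (auto simp: l_def)
  have N: "\<And>j. j \<le> lam \<Longrightarrow> N ! j = 0 \<or> N ! j = 1"
    using binary_expansion_nth[OF bin] len by simp
  \<comment> \<open>If \<open>l = lam\<close>, the update at \<open>l + 1\<close> falls outside the
    list and has no effect; the start index then already exceeds \<open>lam\<close>, so the loop
    does not run.\<close>
  have 1: "comp_time 1 A (toNAF (N[l := - 1, l + 1 := 1]) (l + 1)) (lam + 1)
      \<le> 1 + (real lam + 2) * A / 2"
  proof (rule comp_time_toNAF_le[OF A])
    fix j assume "j < l + 1"
    then show "\<bar>N[l := - 1, l + 1 := 1] ! j\<bar> \<le> 1"
      using l len by (cases "j = l") auto
  qed (use l N len in \<open>auto simp: nth_list_update\<close>)
  have 2: "comp_time 1 A (toNAF N (l + 1)) (lam + 1) \<le> 1 + (real lam + 2) * A / 2"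
    by (rule comp_time_toNAF_le[OF A]) (use l N len in \<open>auto simp: less_Suc_eq\<close>)
  have 3: "comp_time 1 A (toNAF N l) (lam + 1) \<le> 1 + (real lam + 2) * A / 2"
    by (rule comp_time_toNAF_le[OF A]) (use l N len in auto)
  show ?thesis using 1 2 3 by (simp add: algorithm2_def Let_def flip: l_def)
qed

section \<open>Algorithm 3\<close>

lemma recode_block_nth:
  assumes "j < length N"
  shows "recode_block N l i ! j = (if j = l then - 1 else if l < j \<and> j < i then N ! j - 1
    else if j = i then 1 else N ! j)"
  using assms by (simp add: recode_block_def)

lemma length_recode_block [simp]: "length (recode_block N l i) = length N"
  by (simp add: recode_block_def)

text \<open>
  The state after the iteration with index \<open>i\<close> of Algorithm 3 run on \<open>N0\<close>.  There is no current block
  when \<open>l = i + 1\<close>.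
\<close>

definition algorithm3_inv :: "real \<Rightarrow> int list \<Rightarrow> nat \<Rightarrow> int list \<times> nat \<times> real \<Rightarrow> bool" where
  "algorithm3_inv A N0 i = (\<lambda>(N, l, d).
     length N = length N0 \<and> l \<le> i + 1
     \<and> (\<forall>j. l \<le> j \<longrightarrow> j < length N0 \<longrightarrow> N ! j \<in> {0, 1})
     \<and> (\<forall>j>i. j < length N0 \<longrightarrow> N ! j = N0 ! j)
     \<and> comp_time 1 A N i \<le> real i + d
     \<and> (N0 ! i = 0 \<longrightarrow> d \<le> A)
     \<and> (l = i + 1 \<longrightarrow> d \<le> 1)
     \<and> (l \<le> i \<longrightarrow> comp_time 1 A (recode_block N l (i + 1)) i \<le> real i + 2 * A - d
          \<and> (d \<ge> 1 \<or> comp_time 1 A (recode_block N l (i + 1)) i \<le> real i + A)))"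

text \<open>The recoded block is timed only up to \<open>i\<close>, just below its closing digit 1.
  The disjunction with \<open>d \<ge> 1\<close> covers the initial value \<open>d = 0\<close>: there
  the next one resets \<open>d\<close> to \<open>A\<close>, and the bound \<open>2 * A - d\<close>
  alone would not suffice.\<close>

lemma algorithm3_inv_step:
  assumes A: "1 \<le> A" "A \<le> 2" and i: "Suc i < length N0"
    and inv: "algorithm3_inv A N0 i st"
  shows "algorithm3_inv A N0 (Suc i) (algorithm3_step A (Suc i) st)"
proof -
  obtain N l d where st [simp]: "st = (N, l, d)" by (metis prod_cases3)
  have len: "length N = length N0" and li: "l \<le> i + 1"
    and bin: "\<And>j. l \<le> j \<Longrightarrow> j < length N0 \<Longrightarrow> N ! j = 0 \<or> N ! j = 1"
    and same: "\<And>j. i < j \<Longrightarrow> j < length N0 \<Longrightarrow> N ! j = N0 ! j"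
    and T: "comp_time 1 A N i \<le> real i + d"
    and idle: "l = i + 1 \<Longrightarrow> d \<le> 1"
    and block: "l \<le> i \<Longrightarrow> comp_time 1 A (recode_block N l (i + 1)) i \<le> real i + 2 * A - d"
      "l \<le> i \<Longrightarrow> d \<ge> 1 \<or> comp_time 1 A (recode_block N l (i + 1)) i \<le> real i + A"
    using inv by (auto simp: algorithm3_inv_def)
  have Ni: "N ! Suc i = N0 ! Suc i" "N ! Suc i = 0 \<or> N ! Suc i = 1"
    using same[of "Suc i"] bin[of "Suc i"] i li by auto
  have bin0: "N0 ! j = 0 \<or> N0 ! j = 1" if "i < j" "j < length N0" for j
    using same[of j] bin[of j] li that by auto
  \<comment> \<open>The current block as if it were closed one position later; up to
    \<open>i\<close> it agrees with the recoding in the invariant.\<close>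
  define R where "R = recode_block N l (Suc (Suc i))"
  have Rnth: "R ! j = (if j = l then - 1 else if l < j then N ! j - 1 else N ! j)"
    if "j \<le> Suc i" for j
    using that i len by (auto simp: R_def recode_block_nth)
  have RT: "comp_time 1 A R i = comp_time 1 A (recode_block N l (i + 1)) i" if "l \<le> i"
    using i len that by (intro comp_time_cong) (auto simp: Rnth recode_block_nth)
  have RT': "comp_time 1 A R i = comp_time 1 A N i" if "l = Suc i"
    using that by (intro comp_time_cong) (auto simp: Rnth)
  have R_le: "comp_time 1 A R (Suc i) \<le> max (comp_time 1 A R i) (real (Suc i)) + A"
    using comp_time_digit_le[of "Suc i" R A 1] Rnth[of "Suc i"] Ni A by auto
  show ?thesis
  proof (cases "N ! Suc i = 1")
    case True
    let ?d = "max (d + (A - 1)) A"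
    have step: "algorithm3_step A (Suc i) st = (N, l, ?d)"
      using True by (simp add: algorithm3_step_def)
    have T': "comp_time 1 A N (Suc i) \<le> real (Suc i) + ?d"
      using comp_time_digit_le[of "Suc i" N A 1] True T A by auto
    \<comment> \<open>Inside a block, the digit 1 becomes 0 in \<open>R\<close>: the excess of
      \<open>R\<close> drops by one while \<open>d\<close> grows by \<open>A - 1 \<le> 1\<close>, or
      is reset to \<open>A\<close>.\<close>
    have "comp_time 1 A R (Suc i) \<le> real (Suc i) + 2 * A - ?d"
    proof (cases "l = Suc i")
      case True
      then show ?thesis using R_le RT' T idle A by auto
    next
      case False
      then have "R ! Suc i = 0" using Rnth[of "Suc i"] True li by auto
      then have "comp_time 1 A R (Suc i) = comp_time 1 A R i"
        using comp_time_zero_digit[of "Suc i" R] by simp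
      then show ?thesis using RT block False li A by auto
    qed
    then show ?thesis
      unfolding step algorithm3_inv_def using len li bin same T' True Ni A
      by (auto simp flip: R_def)
  next
    case zero: False
    then have N0: "N ! Suc i = 0" using Ni by simp
    then have T': "comp_time 1 A N (Suc i) \<le> real i + d"
      using comp_time_zero_digit[of "Suc i" N] T by simp
    consider (recode) "d - 1 > A" | (reset) "d - 1 \<le> A" "d - 1 \<le> 1"
      | (keep) "d - 1 \<le> A" "d - 1 > 1" by linarith
    then show ?thesis
    proof cases
      case recode
      let ?M = "recode_block N l (Suc i)"
      \<comment> \<open>The closing digit 1 opens the next block; \<open>?M'\<close> is its
        tentative recoding, with -1 there instead.\<close>
      let ?M' = "recode_block ?M (Suc i) (Suc (Suc i))"
      have step: "algorithm3_step A (Suc i) st = (?M, Suc i, A)"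
        using N0 recode by (simp add: algorithm3_step_def)
      have l: "l \<le> i" using idle recode A li by (cases "l = i + 1") auto
      have M: "comp_time 1 A ?M i = comp_time 1 A R i"
        using i len by (intro comp_time_cong) (auto simp: Rnth recode_block_nth)
      have M': "comp_time 1 A ?M' i = comp_time 1 A R i"
        unfolding M[symmetric] using i len by (intro comp_time_cong) (auto simp: recode_block_nth)
      \<comment> \<open>From \<open>d > A + 1\<close>, the excess \<open>2 * A - d\<close> is below
        \<open>A - 1 \<le> 1\<close>.\<close>
      have Ri: "comp_time 1 A R i \<le> real (Suc i)"
        using RT block(1) l recode A by auto
      have "comp_time 1 A ?M (Suc i) \<le> real (Suc i) + A"
        using comp_time_digit_le[of "Suc i" ?M A 1] i len l M Ri A by (simp add: recode_block_nth)
      moreover have "comp_time 1 A ?M' (Suc i) \<le> real (Suc i) + A"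
        using comp_time_digit_le[of "Suc i" ?M' A 1] i len M' Ri A by (simp add: recode_block_nth)
      ultimately show ?thesis
        unfolding step algorithm3_inv_def using len l bin0 same A i
        by (auto simp: recode_block_nth)
    next
      case reset
      then have step: "algorithm3_step A (Suc i) st = (N, Suc i + 1, d - 1)"
        using N0 by (simp add: algorithm3_step_def)
      show ?thesis
        unfolding step algorithm3_inv_def using len li bin0 same T' reset by auto
    next
      case keep
      then have step: "algorithm3_step A (Suc i) st = (N, l, d - 1)"
        using N0 by (simp add: algorithm3_step_def)
      have l: "l \<le> i" using idle keep A li by (cases "l = i + 1") auto
      \<comment> \<open>The zero becomes -1 in \<open>R\<close>. The two arguments of the maximum
        are handled by \<open>A \<le> 2\<close> and \<open>d \<le> A + 1\<close>,
        respectively.\<close>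
      then have "comp_time 1 A R (Suc i) \<le> real (Suc i) + 2 * A - (d - 1)"
        using R_le RT block(1) keep A by auto
      then show ?thesis
        unfolding step algorithm3_inv_def using len l bin same T' keep
        by (auto simp flip: R_def)
    qed
  qed
qed

lemma algorithm3_inv_fold:
  assumes "1 \<le> A" "A \<le> 2" "algorithm3_inv A N0 l st" "l \<le> k" "k < length N0"
  shows "algorithm3_inv A N0 k (fold (algorithm3_step A) [l + 1..<k + 1] st)"
  using assms(4,5)
proof (induction k rule: dec_induct)
  case base
  then show ?case using assms(3) by simp
next
  case (step k)
  then show ?case using algorithm3_inv_step[OF assms(1,2)] by simp
qed

lemma comp_time_algorithm3_le:
  assumes A: "1 \<le> A" "A \<le> 2" and bin: "binary_expansion N n" and len: "length N = lam + 1"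
  shows "comp_time 1 A (algorithm3 A N) (lam + 1) \<le> real lam + 1 + A"
proof -
  define l where "l = lsb_index N"
  let ?N = "N @ [0]"
  let ?R = "recode_block ?N l (l + 1)"
  have l: "l \<le> lam" "N ! l = 1" "\<And>j. j < l \<Longrightarrow> N ! j = 0"
    using lsb_index_spec[OF bin] len by (auto simp: l_def)
  have "comp_time 1 A ?N l = real l"
    using comp_time_lowest_digit[of ?N l 1 A] l len by (simp add: nth_append)
  moreover have "comp_time 1 A ?R l = real l"
    using comp_time_lowest_digit[of ?R l 1 A] l len by (simp add: nth_append recode_block_nth)
  moreover have "?N ! j \<in> {0, 1}" if "j < length ?N" for j
    using binary_expansion_nth[OF bin, of j] that len by (auto simp: nth_append)
  \<comment> \<open>Neither 1 nor -1 at the lowest nonzero position needs an addition, so both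
    versions start with excess 0.\<close>
  ultimately have "algorithm3_inv A ?N l (?N, l, 0)"
    using A l len by (simp add: algorithm3_inv_def nth_append)
  then have inv: "algorithm3_inv A ?N (lam + 1)
      (fold (algorithm3_step A) [l + 1..<lam + 1 + 1] (?N, l, 0))"
    using l len by (intro algorithm3_inv_fold[OF A]) auto
  obtain M l' d where
    fold: "fold (algorithm3_step A) [l + 1..<lam + 1 + 1] (?N, l, 0) = (M, l', d)"
    by (metis prod_cases3)
  \<comment> \<open>The input digit at \<open>lam + 1\<close> is the appended zero, which gives
    \<open>d \<le> A\<close>.\<close>
  have "comp_time 1 A M (lam + 1) \<le> real (lam + 1) + d" "d \<le> A"
    using inv len unfolding fold algorithm3_inv_def by (auto simp: nth_append)
  moreover have "algorithm3 A N = M"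
    using fold len by (simp add: algorithm3_def flip: l_def)
  ultimately show ?thesis by simp
qed

section \<open>Comparison with the two-processor bound\<close>

theorem theorem3:
  fixes D A :: real and lam n :: nat and NB Nstar :: "int list"
  assumes "D = 1" and "A \<ge> 1"
    and "lam > 0"
    and "real lam \<ge> max (4 / 3 * A + 4 / 3) (3 + 3 / A)"
    and "n > 0"
    and "binary_expansion NB n" and "length NB = lam + 1"
    and "Nstar = (if A \<ge> 2 then algorithm2 NB else algorithm3 A NB)"
  shows "comp_time D A Nstar (lam + 1) \<le> real lam * D + A / (2 * A + 1) * (real lam + 1) * A"
proof (cases "A \<ge> 2")
  case True
  have lam: "real lam \<ge> 4 / 3 * A + 4 / 3" using assms(4) by simp
  have "comp_time D A Nstar (lam + 1) \<le> 1 + (real lam + 2) * A / 2"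
    using comp_time_algorithm2_le[OF True assms(6,7)] assms(1,8) True by simp
  \<comment> \<open>\<open>A / 2 - 1 / 4\<close> is the polynomial part of
    \<open>A * A / (2 * A + 1)\<close>: its product with \<open>2 * A + 1\<close> is
    \<open>A * A - 1 / 4\<close>.\<close>
  also have "\<dots> \<le> real lam + (A / 2 - 1 / 4) * (real lam + 1)"
    using lam True by (simp add: algebra_simps add_divide_distrib)
  also have "(A / 2 - 1 / 4) * (real lam + 1) \<le> A / (2 * A + 1) * A * (real lam + 1)"
    using True by (intro mult_right_mono) (simp_all add: field_simps)
  finally show ?thesis using assms(1) by (simp add: algebra_simps)
next
  case False
  have lam: "real lam + 1 \<ge> 4 + 3 / A" using assms(4) by simp
  have "comp_time D A Nstar (lam + 1) \<le> real lam + (1 + A)"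
    using comp_time_algorithm3_le[OF assms(2) _ assms(6,7)] assms(1,8) False by simp
  \<comment> \<open>At the least admissible value of \<open>lam + 1\<close>, the claim reduces to
    \<open>1 \<le> 2 * (A * A)\<close>.\<close>
  also have "1 + A \<le> A / (2 * A + 1) * A * (4 + 3 / A)"
  proof -
    have "1 \<le> A * A" using assms(2) mult_mono[of 1 A 1 A] by simp
    then have "(1 + A) * (2 * A + 1) \<le> 4 * (A * A) + 3 * A"
      using assms(2) by (simp add: algebra_simps)
    then have "1 + A \<le> (4 * (A * A) + 3 * A) / (2 * A + 1)"
      using assms(2) by (simp add: pos_le_divide_eq)
    also have "\<dots> = A / (2 * A + 1) * A * (4 + 3 / A)"
      using assms(2) by (simp add: distrib_left add_divide_distrib mult_ac)
    finally show ?thesis .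
  qed
  also have "\<dots> \<le> A / (2 * A + 1) * A * (real lam + 1)"
    using lam assms(2) by (intro mult_left_mono) auto
  finally show ?thesis using assms(1) by (simp add: algebra_simps)
qed

end
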